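(* Let $(X,\rho)$ be a metric space with $|X|\geq 3$, let $\lambda\in[0,1)$, and let $T:X\to CB(X)$ be a multivalued $\lambda$-contracting perimeters of triangles mapping on $X$, i.e. $$H(Tx,Ty)+H(Ty,Tz)+H(Tx,Tz)\leq \lambda\left(\rho(x,y)+\rho(y,z)+\rho(x,z)\right)$$ for all three pairwise distinct points $x,y,z\in X$. If $x$ is an accumulation point of $X$, then $$H(Tx,Ty)\leq\lambda\rho(x,y)$$ for all $y\in X$.
   Context: For a metric space $(X,\rho)$, $CB(X)$ denotes the class of all nonempty closed and bounded subsets of $X$, and $H$ is the Pompeiu–Hausdorff metric on $CB(X)$ induced by $\rho$: $H(A,B)=\max\{\sup_{a\in A}\rho(a,B),\ \sup_{b\in B}\rho(b,A)\}$, where $\rho(a,B)=\inf_{b\in B}\rho(a,b)$. *)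

theory Defs
  imports "HOL-Analysis.Analysis"
begin

definition CB :: "'a::metric_space set set" where
  "CB = {A. A \<noteq> {} \<and> closed A \<and> bounded A}"

(* Meaningful on CB only: there both suprema range over nonempty sets of reals that are
   bounded above, and infdist (which is 0 for the empty set) is the infimum of distances. *)
definition pompeiu_hausdorff :: "'a::metric_space set \<Rightarrow> 'a set \<Rightarrow> real" where
  "pompeiu_hausdorff A B = max (SUP a\<in>A. infdist a B) (SUP b\<in>B. infdist b A)"

definition contracting_perimeters :: "real \<Rightarrow> ('a::metric_space \<Rightarrow> 'a set) \<Rightarrow> bool" where
  "contracting_perimeters l T \<longleftrightarrow>
     (\<forall>x y z. x \<noteq> y \<and> y \<noteq> z \<and> x \<noteq> z \<longrightarrow>
        pompeiu_hausdorff (T x) (T y) + pompeiu_hausdorff (T y) (T z) + pompeiu_hausdorff (T x) (T z)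
          \<le> l * (dist x y + dist y z + dist x z))"

end

theory Submission
  imports Defs
begin

text \<open>
  If \<open>z\<close> is distinct from \<open>x\<close> and \<open>y\<close>, the triangle inequality for the Hausdorff distance bounds
  \<open>2 H(Tx,Ty)\<close> by the perimeter of \<open>Tx\<close>, \<open>Ty\<close>, \<open>Tz\<close>, so the hypothesis gives
  \<open>H(Tx,Ty) \<le> l (\<rho>(x,y) + \<rho>(x,z))\<close>. Since \<open>x\<close> is an accumulation point, \<open>z\<close> can tend to \<open>x\<close>.
\<close>

text \<open>For a fixed \<open>b\<close> in \<open>B\<close>, \<open>infdist a B\<close> is at most
  \<open>dist a b\<close>, which is bounded over \<open>A\<close>. This makes the suprema in
  \<open>pompeiu_hausdorff\<close> genuine upper bounds.\<close>

lemma bdd_above_infdist: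
  fixes A B :: "'a::metric_space set"
  assumes "bounded A" "B \<noteq> {}"
  shows "bdd_above ((\<lambda>a. infdist a B) ` A)"
proof -
  obtain b where b: "b \<in> B" using assms(2) by blast
  obtain e where "\<forall>a\<in>A. dist b a \<le> e"
    using assms(1) bounded_any_center[of A b] by blast
  then show ?thesis
    by (intro bdd_aboveI2[where M = e]) (metis b dist_commute infdist_le2)
qed

lemma infdist_le_pompeiu_hausdorff:
  assumes "A \<in> CB" "B \<in> CB" "a \<in> A"
  shows "infdist a B \<le> pompeiu_hausdorff A B"
proof -
  have "infdist a B \<le> (SUP a\<in>A. infdist a B)"
    using assms by (intro cSUP_upper bdd_above_infdist) (auto simp: CB_def)
  then show ?thesis
    by (simp add: pompeiu_hausdorff_def)
qed

lemma pompeiu_hausdorff_commute: "pompeiu_hausdorff A B = pompeiu_hausdorff B A"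
  by (simp add: pompeiu_hausdorff_def max.commute)

lemma pompeiu_hausdorff_refl:
  assumes "A \<in> CB"
  shows "pompeiu_hausdorff A A = 0"
  using assms by (simp add: pompeiu_hausdorff_def CB_def)

text \<open>Pointwise form of the triangle inequality: subtracting the Hausdorff distance of
  \<open>B\<close> and \<open>C\<close> from \<open>infdist a C\<close> leaves a lower bound of
  \<open>dist a b\<close> over all \<open>b\<close> in \<open>B\<close>, hence of
  \<open>infdist a B\<close>.\<close>

lemma infdist_le_pompeiu_hausdorff_add:
  assumes "A \<in> CB" "B \<in> CB" "C \<in> CB" "a \<in> A"
  shows "infdist a C \<le> pompeiu_hausdorff A B + pompeiu_hausdorff B C"
proof -
  have "infdist a C - pompeiu_hausdorff B C \<le> dist a b" if "b \<in> B" for b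
    using infdist_triangle[of a C b] infdist_le_pompeiu_hausdorff[OF assms(2,3) that] by linarith
  moreover have "B \<noteq> {}" using assms(2) by (simp add: CB_def)
  ultimately have "infdist a C - pompeiu_hausdorff B C \<le> infdist a B"
    by (simp add: infdist_notempty cINF_greatest)
  then show ?thesis
    using infdist_le_pompeiu_hausdorff[OF assms(1,2,4)] by linarith
qed

text \<open>The pointwise bound handles one supremum; exchanging \<open>A\<close> and
  \<open>C\<close> handles the other.\<close>

lemma pompeiu_hausdorff_triangle:
  assumes "A \<in> CB" "B \<in> CB" "C \<in> CB"
  shows "pompeiu_hausdorff A C \<le> pompeiu_hausdorff A B + pompeiu_hausdorff B C"
proof -
  have "A \<noteq> {}" "C \<noteq> {}" using assms by (auto simp: CB_def)
  moreover have "infdist c A \<le> pompeiu_hausdorff A B + pompeiu_hausdorff B C" if "c \<in> C" for c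
    using infdist_le_pompeiu_hausdorff_add[OF assms(3,2,1) that]
    by (simp add: pompeiu_hausdorff_commute add.commute)
  ultimately show ?thesis
    unfolding pompeiu_hausdorff_def[of A C]
    by (intro max.boundedI cSUP_least infdist_le_pompeiu_hausdorff_add assms) auto
qed

theorem proposition2:
  fixes T :: "'a::metric_space \<Rightarrow> 'a set" and l :: real and x :: 'a
  assumes "infinite (UNIV :: 'a set) \<or> card (UNIV :: 'a set) \<ge> 3"
    and "0 \<le> l" and "l < 1"
    and "\<forall>u. T u \<in> CB"
    and "contracting_perimeters l T"
    and "x islimpt UNIV"
  shows "\<forall>y. pompeiu_hausdorff (T x) (T y) \<le> l * dist x y"
proof
  fix y
  let ?H = "\<lambda>u v. pompeiu_hausdorff (T u) (T v)"
  show "?H x y \<le> l * dist x y"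
  proof (cases "y = x")
    case True
    then show ?thesis using assms(4) by (simp add: pompeiu_hausdorff_refl)
  next
    case False
    show ?thesis
    proof (rule field_le_epsilon)
      fix e :: real assume "0 < e"
      \<comment> \<open>The bound \<open>e\<close> controls the error, while \<open>dist x y\<close>
        keeps \<open>z\<close> away from \<open>y\<close>, so that the three points are pairwise
        distinct.\<close>
      then have "0 < min e (dist x y)" using False by simp
      then obtain z where z: "z \<noteq> x" "dist z x < min e (dist x y)"
        using assms(6) unfolding islimpt_approachable by blast
      then have "y \<noteq> z" by (auto simp: dist_commute)
      then have "?H x y + ?H y z + ?H x z \<le> l * (dist x y + dist y z + dist x z)"
        using assms(5) False z(1) unfolding contracting_perimeters_def by metis
      moreover have "?H x y \<le> ?H x z + ?H y z"
        using pompeiu_hausdorff_triangle[of "T x" "T z" "T y"] assms(4)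
        by (simp add: pompeiu_hausdorff_commute)
      moreover have "l * (dist x y + dist y z + dist x z) \<le> l * (2 * dist x y + 2 * dist x z)"
        using assms(2) dist_triangle[of y z x] by (intro mult_left_mono) (auto simp: dist_commute)
      \<comment> \<open>Halving the combined estimates leaves \<open>l * dist x z\<close> as the
        only excess over \<open>l * dist x y\<close>.\<close>
      moreover have "l * dist x z \<le> 1 * e"
        using assms(2,3) z(2) by (intro mult_mono) (auto simp: dist_commute)
      ultimately show "?H x y \<le> l * dist x y + e"
        by (simp add: distrib_left)
    qed
  qed
qed

end
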